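(* Let $F=f+\psi$ be as in the context, satisfying the smoothness assumption with vector $L$ and the local quadratic error bound assumption. Let $x_0\in\operatorname{dom}(F)$, let $K\ge 1$ be an integer, and let $\hat x$ be the output of FISTA$(x_0,K)$ or of APG$(x_0,K)$. Then $$\operatorname{dist}_L(\hat x,\mathcal X_\star)^2\le \min\left(\frac{\theta_{K-1}^2}{\mu_F(L,x_0)},\ \frac{1}{1+\frac{\mu_F(L,x_0)}{2\theta_{K-1}^2}}\right)\operatorname{dist}_L(x_0,\mathcal X_\star)^2 .$$
   Context: Setting: $f:\mathbb R^n\to\mathbb R$ is convex and differentiable, $\psi:\mathbb R^n\to\mathbb R\cup\{+\infty\}$ is proper, closed and convex, $F:=f+\psi$, $F^\star:=\min_{\mathbb R^n}F$, and the set $\mathcal X_\star$ of minimizers of $F$ is nonempty. For a vector $v$ with positive entries, $\|x\|_v^2:=\sum_{i=1}^n v_i(x^i)^2$, and $\operatorname{dist}_v(x,\mathcal X_\star)$ is the distance from $x$ to $\mathcal X_\star$ in the norm $\|\cdot\|_v$. Smoothness assumption: there is $L\in\mathbb R^n$ with positive entries such that $f(x)\le f(y)+\langle\nabla f(y),x-y\rangle+\frac12\|x-y\|_L^2$ for all $x,y\in\mathbb R^n$. Local quadratic error bound assumption: for every $x_0\in\operatorname{dom}(F)$ there is a constant $\mu_F(L,x_0)>0$ such that $F(x)\ge F^\star+\frac{\mu_F(L,x_0)}{2}\operatorname{dist}_L(x,\mathcal X_\star)^2$ for all $x$ with $F(x)\le F(x_0)$. Sequence $(\theta_k)$: $\theta_0=1$,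 $\theta_{k+1}=\frac{\sqrt{\theta_k^4+4\theta_k^2}-\theta_k^2}{2}$. FISTA$(x_0,K)$: set $z_0=x_0$; for $k=0,\dots,K-1$ set $y_k=(1-\theta_k)x_k+\theta_kz_k$, $x_{k+1}=\arg\min_{x}\{\langle\nabla f(y_k),x-y_k\rangle+\frac12\|x-y_k\|_L^2+\psi(x)\}$, $z_{k+1}=z_k+\frac1{\theta_k}(x_{k+1}-y_k)$. The output is $x_K$. APG$(x_0,K)$: set $z_0=x_0$; for $k=0,\dots,K-1$ set $y_k=(1-\theta_k)x_k+\theta_kz_k$, $z_{k+1}=\arg\min_{z}\{\langle\nabla f(y_k),z-y_k\rangle+\frac{\theta_k}2\|z-z_k\|_L^2+\psi(z)\}$, $x_{k+1}=y_k+\theta_k(z_{k+1}-z_k)$. The output is $x_K$. *)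

theory Defs
  imports "HOL-Analysis.Analysis"
begin

definition domain_of :: "('a \<Rightarrow> ereal) \<Rightarrow> 'a set" where
  "domain_of g = {x. g x < \<infinity>}"

text \<open>The library's \<open>epigraph\<close> is for real-valued functions; as there, heights are real.\<close>
definition ereal_epigraph :: "('a \<Rightarrow> ereal) \<Rightarrow> ('a \<times> real) set" where
  "ereal_epigraph g = {(x, r). g x \<le> ereal r}"

definition proper_function :: "('a \<Rightarrow> ereal) \<Rightarrow> bool" where
  "proper_function g \<longleftrightarrow> (\<forall>x. g x \<noteq> -\<infinity>) \<and> (\<exists>x. g x \<noteq> \<infinity>)"

definition closed_function :: "('a::topological_space \<Rightarrow> ereal) \<Rightarrow> bool" where
  "closed_function g \<longleftrightarrow> closed (ereal_epigraph g)"

definition convex_function :: "('a::real_vector \<Rightarrow> ereal) \<Rightarrow> bool" where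
  "convex_function g \<longleftrightarrow> convex (ereal_epigraph g)"

definition gradient :: "('a::real_inner \<Rightarrow> real) \<Rightarrow> 'a \<Rightarrow> 'a" where
  "gradient f x = (THE d. GDERIV f x :> d)"

definition composite :: "('a \<Rightarrow> real) \<Rightarrow> ('a \<Rightarrow> ereal) \<Rightarrow> 'a \<Rightarrow> ereal" where
  "composite f \<psi> x = ereal (f x) + \<psi> x"

definition opt_value :: "('a \<Rightarrow> ereal) \<Rightarrow> ereal" where
  "opt_value F = (INF x. F x)"

definition minimizers :: "('a \<Rightarrow> ereal) \<Rightarrow> 'a set" where
  "minimizers F = {x. \<forall>y. F x \<le> F y}"

definition wnorm :: "real ^ 'n \<Rightarrow> real ^ 'n \<Rightarrow> real" where
  "wnorm v x = sqrt (\<Sum>i\<in>UNIV. v $ i * (x $ i)\<^sup>2)"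

text \<open>Only meaningful for nonempty \<open>X\<close>, like the infimum of reals it is built from.\<close>
definition wdist :: "real ^ 'n \<Rightarrow> real ^ 'n \<Rightarrow> (real ^ 'n) set \<Rightarrow> real" where
  "wdist v x X = (INF y\<in>X. wnorm v (x - y))"

definition smoothness :: "(real ^ 'n \<Rightarrow> real) \<Rightarrow> real ^ 'n \<Rightarrow> bool" where
  "smoothness f L \<longleftrightarrow> (\<forall>i. L $ i > 0) \<and>
     (\<forall>x y. f x \<le> f y + gradient f y \<bullet> (x - y) + 1/2 * (wnorm L (x - y))\<^sup>2)"

text \<open>The function \<open>\<mu>\<close> collects the constants, one for each starting point, for the fixed
  weight vector \<open>L\<close>.\<close>
definition local_quadratic_error_bound ::
    "(real ^ 'n \<Rightarrow> ereal) \<Rightarrow> real ^ 'n \<Rightarrow> (real ^ 'n \<Rightarrow> real) \<Rightarrow> bool" where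
  "local_quadratic_error_bound F L \<mu> \<longleftrightarrow>
     (\<forall>x0\<in>domain_of F. \<mu> x0 > 0 \<and>
        (\<forall>x. F x \<le> F x0 \<longrightarrow>
           F x \<ge> opt_value F + ereal (\<mu> x0 / 2 * (wdist L x (minimizers F))\<^sup>2)))"

primrec \<theta> :: "nat \<Rightarrow> real" where
  "\<theta> 0 = 1"
| "\<theta> (Suc k) = (sqrt (\<theta> k ^ 4 + 4 * (\<theta> k)\<^sup>2) - (\<theta> k)\<^sup>2) / 2"

text \<open>\<open>arg_min\<close> selects some minimizer. For proper closed convex \<open>\<psi>\<close>, positive \<open>L\<close> and \<open>t > 0\<close>
  the objectives below are strongly convex, so the minimizer exists and is unique.\<close>

definition fista_step ::
    "(real ^ 'n \<Rightarrow> real) \<Rightarrow> (real ^ 'n \<Rightarrow> ereal) \<Rightarrow> real ^ 'n \<Rightarrow> real ^ 'n \<Rightarrow> real ^ 'n" where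
  "fista_step f \<psi> L y =
     arg_min (\<lambda>x. ereal (gradient f y \<bullet> (x - y) + 1/2 * (wnorm L (x - y))\<^sup>2) + \<psi> x) (\<lambda>x. True)"

definition apg_step ::
    "(real ^ 'n \<Rightarrow> real) \<Rightarrow> (real ^ 'n \<Rightarrow> ereal) \<Rightarrow> real ^ 'n \<Rightarrow> real \<Rightarrow> real ^ 'n \<Rightarrow> real ^ 'n \<Rightarrow> real ^ 'n"
  where
  "apg_step f \<psi> L t y zk =
     arg_min (\<lambda>z. ereal (gradient f y \<bullet> (z - y) + t / 2 * (wnorm L (z - zk))\<^sup>2) + \<psi> z) (\<lambda>z. True)"

text \<open>The iterations carry the pair \<open>(x\<^sub>k, z\<^sub>k)\<close>.\<close>

primrec fista_iter ::
    "(real ^ 'n \<Rightarrow> real) \<Rightarrow> (real ^ 'n \<Rightarrow> ereal) \<Rightarrow> real ^ 'n \<Rightarrow> real ^ 'n \<Rightarrow> nat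
      \<Rightarrow> (real ^ 'n) \<times> (real ^ 'n)" where
  "fista_iter f \<psi> L x0 0 = (x0, x0)"
| "fista_iter f \<psi> L x0 (Suc k) =
     (let (x, z) = fista_iter f \<psi> L x0 k;
          y = (1 - \<theta> k) *\<^sub>R x + \<theta> k *\<^sub>R z;
          x' = fista_step f \<psi> L y
      in (x', z + (1 / \<theta> k) *\<^sub>R (x' - y)))"

primrec apg_iter ::
    "(real ^ 'n \<Rightarrow> real) \<Rightarrow> (real ^ 'n \<Rightarrow> ereal) \<Rightarrow> real ^ 'n \<Rightarrow> real ^ 'n \<Rightarrow> nat
      \<Rightarrow> (real ^ 'n) \<times> (real ^ 'n)" where
  "apg_iter f \<psi> L x0 0 = (x0, x0)"
| "apg_iter f \<psi> L x0 (Suc k) =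
     (let (x, z) = apg_iter f \<psi> L x0 k;
          y = (1 - \<theta> k) *\<^sub>R x + \<theta> k *\<^sub>R z;
          z' = apg_step f \<psi> L (\<theta> k) y z
      in (y + \<theta> k *\<^sub>R (z' - z), z'))"

definition fista ::
    "(real ^ 'n \<Rightarrow> real) \<Rightarrow> (real ^ 'n \<Rightarrow> ereal) \<Rightarrow> real ^ 'n \<Rightarrow> real ^ 'n \<Rightarrow> nat \<Rightarrow> real ^ 'n" where
  "fista f \<psi> L x0 K = fst (fista_iter f \<psi> L x0 K)"

definition apg ::
    "(real ^ 'n \<Rightarrow> real) \<Rightarrow> (real ^ 'n \<Rightarrow> ereal) \<Rightarrow> real ^ 'n \<Rightarrow> real ^ 'n \<Rightarrow> nat \<Rightarrow> real ^ 'n" where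
  "apg f \<psi> L x0 K = fst (apg_iter f \<psi> L x0 K)"

end

theory Submission
  imports Defs
begin

text \<open>
  One step of either method with parameter \<open>t\<close> satisfies, for every \<open>w\<close> in the domain,
  \<open>F x' \<le> (1 - t) F x + t F w + t\<^sup>2/2 (\<parallel>w - z\<parallel>\<^sup>2 - \<parallel>w - z'\<parallel>\<^sup>2)\<close> and \<open>x' = (1 - t) x + t z'\<close>.
  Since \<open>\<theta>\<^sub>k\<^sub>+\<^sub>1\<^sup>2 = (1 - \<theta>\<^sub>k\<^sub>+\<^sub>1) \<theta>\<^sub>k\<^sup>2\<close>, this telescopes to
  \<open>F x\<^sub>k - F w \<le> \<theta>\<^sub>k\<^sub>-\<^sub>1\<^sup>2/2 (\<parallel>w - x\<^sub>0\<parallel>\<^sup>2 - \<parallel>w - z\<^sub>k\<parallel>\<^sup>2)\<close>. Taking \<open>w = x\<^sub>0\<close> shows that the error bound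
  applies to \<open>x\<^sub>k\<close>; taking \<open>w\<close> a minimizer gives the first term of the minimum. For the second
  term let \<open>d\<close> be the squared distance to the minimizers, which is a convex function. Then
  \<open>d x\<^sub>k\<^sub>+\<^sub>1 \<le> (1 - \<theta>\<^sub>k) d x\<^sub>k + \<theta>\<^sub>k d z\<^sub>k\<^sub>+\<^sub>1\<close> and \<open>d z\<^sub>k\<^sub>+\<^sub>1 \<le> d x\<^sub>0 - \<mu>/\<theta>\<^sub>k\<^sup>2 d x\<^sub>k\<^sub>+\<^sub>1\<close>, and the bound follows
  by induction on \<open>k\<close>.
\<close>

text \<open>Serves the two first-order arguments below, where a minimizer is compared with the point
  at fraction \<open>s\<close> of a segment, the inequality is divided by \<open>s\<close>, and
  \<open>s\<close> tends to 0.\<close>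

lemma le_if_le_plus_small_multiple:
  fixes a b c :: real
  assumes "\<And>s. 0 < s \<Longrightarrow> s < 1 \<Longrightarrow> a \<le> b + s * c"
  shows "a \<le> b"
proof (rule tendsto_lowerbound)
  show "((\<lambda>s. b + s * c) \<longlongrightarrow> b) (at_right 0)"
    by (auto intro!: tendsto_eq_intros)
  show "\<forall>\<^sub>F s in at_right 0. a \<le> b + s * c"
    unfolding eventually_at_right_field using assms by (intro exI[of _ 1]) auto
qed simp

subsection \<open>The weighted norm and distance\<close>

lemma wnorm_power2:
  assumes "\<And>i. L $ i > 0"
  shows "(wnorm L v)\<^sup>2 = (\<Sum>i\<in>UNIV. L $ i * (v $ i)\<^sup>2)"
  unfolding wnorm_def using assms by (simp add: sum_nonneg less_imp_le)

lemma wnorm_nonneg: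
  assumes "\<And>i. L $ i > 0"
  shows "wnorm L v \<ge> 0"
  unfolding wnorm_def using assms by (simp add: sum_nonneg less_imp_le)

lemma wnorm_scaleR_power2:
  assumes "\<And>i. L $ i > 0"
  shows "(wnorm L (c *\<^sub>R v))\<^sup>2 = c\<^sup>2 * (wnorm L v)\<^sup>2"
  by (simp add: wnorm_power2[OF assms] sum_distrib_left power_mult_distrib mult_ac)

lemma wnorm_minus_commute: "wnorm L (v - w) = wnorm L (w - v)"
  by (simp add: wnorm_def power2_commute)

text \<open>An exact identity, not just convexity: the subtracted term is the strong convexity that
  yields the quadratic gap in the proximal inequality.\<close>

lemma wnorm_power2_convex_combination:
  assumes "\<And>i. L $ i > 0"
  shows "(wnorm L ((1 - s) *\<^sub>R a + s *\<^sub>R b))\<^sup>2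
    = (1 - s) * (wnorm L a)\<^sup>2 + s * (wnorm L b)\<^sup>2 - s * (1 - s) * (wnorm L (a - b))\<^sup>2"
  unfolding wnorm_power2[OF assms] sum_distrib_left sum.distrib[symmetric] sum_subtractf[symmetric]
  by (intro sum.cong) (auto simp: power2_eq_square algebra_simps)

text \<open>The smallest weight serves as \<open>l\<close>. This gives the coercivity that bounds
  sublevel sets of the proximal objective.\<close>

lemma wnorm_power2_ge_norm_power2:
  fixes L :: "real ^ 'n"
  assumes "\<And>i. L $ i > 0"
  obtains l where "l > 0" "\<And>v. (wnorm L v)\<^sup>2 \<ge> l * (norm v)\<^sup>2"
proof
  define l where "l = Min (range (($) L))"
  show "l > 0"
    unfolding l_def using assms by (subst Min_gr_iff) auto
  have l: "l \<le> L $ i" for i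
    unfolding l_def by (rule Min_le) auto
  show "(wnorm L v)\<^sup>2 \<ge> l * (norm v)\<^sup>2" for v
  proof -
    have "l * (norm v)\<^sup>2 = (\<Sum>i\<in>UNIV. l * (v $ i)\<^sup>2)"
      by (simp add: norm_vec_def L2_set_def sum_nonneg sum_distrib_left)
    also have "\<dots> \<le> (\<Sum>i\<in>UNIV. L $ i * (v $ i)\<^sup>2)"
      by (intro sum_mono mult_right_mono l) auto
    finally show ?thesis
      by (simp add: wnorm_power2[OF assms])
  qed
qed

lemma continuous_on_wnorm_power2:
  assumes "\<And>i. L $ i > 0"
  shows "continuous_on A (\<lambda>x. (wnorm L (x - c))\<^sup>2)"
  unfolding wnorm_power2[OF assms] by (intro continuous_intros)

lemma wdist_power2_le:
  assumes "\<And>i. L $ i > 0" "u \<in> X"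
  shows "(wdist L x X)\<^sup>2 \<le> (wnorm L (x - u))\<^sup>2"
proof (rule power_mono)
  have "bdd_below ((\<lambda>y. wnorm L (x - y)) ` X)"
    using wnorm_nonneg[OF assms(1)] by (auto intro!: bdd_belowI[of _ 0])
  then show "wdist L x X \<le> wnorm L (x - u)"
    unfolding wdist_def using assms by (auto intro: cINF_lower)
  show "wdist L x X \<ge> 0"
    unfolding wdist_def using assms wnorm_nonneg[OF assms(1)] by (intro cINF_greatest) auto
qed

text \<open>Lower bounds pass to the infimum, so no nearest point of \<open>X\<close> has to exist.
  A negative \<open>c\<close> is allowed because callers pass differences of unknown sign.\<close>

lemma le_wdist_power2I:
  assumes "X \<noteq> {}" "\<And>i. L $ i > 0" "\<And>u. u \<in> X \<Longrightarrow> c \<le> (wnorm L (x - u))\<^sup>2"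
  shows "c \<le> (wdist L x X)\<^sup>2"
proof (cases "c \<ge> 0")
  case True
  have "sqrt c \<le> wdist L x X"
    unfolding wdist_def
    using assms(1,3) wnorm_nonneg[OF assms(2)] by (intro cINF_greatest) (auto intro: real_le_lsqrt)
  then show ?thesis
    by (rule sqrt_le_D)
next
  case False
  then show ?thesis
    using zero_le_power2[of "wdist L x X"] by linarith
qed

text \<open>For \<open>u\<close> and \<open>v\<close> in \<open>X\<close> their combination is again
  in \<open>X\<close> and bounds the distance on the left. The infimum is then taken over
  \<open>v\<close> and afterwards over \<open>u\<close>; this divides by \<open>s\<close> and by
  \<open>1 - s\<close>, hence the separate cases.\<close>

lemma wdist_power2_convex:
  assumes "convex X" "X \<noteq> {}" "\<And>i. L $ i > 0" "0 \<le> s" "s \<le> 1"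
  shows "(wdist L ((1 - s) *\<^sub>R x + s *\<^sub>R z) X)\<^sup>2 \<le> (1 - s) * (wdist L x X)\<^sup>2 + s * (wdist L z X)\<^sup>2"
proof -
  define d where "d = (wdist L ((1 - s) *\<^sub>R x + s *\<^sub>R z) X)\<^sup>2"
  have *: "d \<le> (1 - s) * (wnorm L (x - u))\<^sup>2 + s * (wnorm L (z - v))\<^sup>2" if "u \<in> X" "v \<in> X" for u v
  proof -
    have "(1 - s) *\<^sub>R u + s *\<^sub>R v \<in> X"
      using assms that by (auto intro: convexD)
    then have "d \<le> (wnorm L ((1 - s) *\<^sub>R x + s *\<^sub>R z - ((1 - s) *\<^sub>R u + s *\<^sub>R v)))\<^sup>2"
      unfolding d_def by (intro wdist_power2_le assms)
    also have "(1 - s) *\<^sub>R x + s *\<^sub>R z - ((1 - s) *\<^sub>R u + s *\<^sub>R v) = (1 - s) *\<^sub>R (x - u) + s *\<^sub>R (z - v)"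
      by (simp add: algebra_simps)
    also have "(wnorm L \<dots>)\<^sup>2 \<le> (1 - s) * (wnorm L (x - u))\<^sup>2 + s * (wnorm L (z - v))\<^sup>2"
      using assms(4,5) by (simp add: wnorm_power2_convex_combination[OF assms(3)])
    finally show ?thesis .
  qed
  have **: "d \<le> (1 - s) * (wnorm L (x - u))\<^sup>2 + s * (wdist L z X)\<^sup>2" if "u \<in> X" for u
  proof (cases "s = 0")
    case True
    then show ?thesis using *[OF that that] by simp
  next
    case False
    have "(d - (1 - s) * (wnorm L (x - u))\<^sup>2) / s \<le> (wdist L z X)\<^sup>2"
      using *[OF that] False assms by (intro le_wdist_power2I) (auto simp: field_simps)
    then show ?thesis
      using False assms by (simp add: field_simps)
  qed
  show ?thesis
  proof (cases "s = 1")
    case True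
    then show ?thesis using ** assms(2) by (auto simp: d_def)
  next
    case False
    have "(d - s * (wdist L z X)\<^sup>2) / (1 - s) \<le> (wdist L x X)\<^sup>2"
      using ** False assms by (intro le_wdist_power2I) (auto simp: field_simps)
    then show ?thesis
      using False assms by (simp add: field_simps d_def)
  qed
qed

subsection \<open>Gradients of convex functions\<close>

text \<open>\<open>gradient\<close> is a definite description, so existence and uniqueness are both
  due. Existence is the Riesz representation of the derivative in the standard basis.\<close>

lemma GDERIV_gradient:
  fixes f :: "'a::euclidean_space \<Rightarrow> real"
  assumes "f differentiable (at x)"
  shows "GDERIV f x :> gradient f x"
proof -
  obtain f' where f': "(f has_derivative f') (at x)"
    using assms by (auto simp: differentiable_def)
  then interpret f': linear f'
    by (rule has_derivative_linear)
  define g where "g = (\<Sum>b\<in>Basis. f' b *\<^sub>R b)"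
  have "f' h = h \<bullet> g" for h
  proof -
    have "f' h = f' (\<Sum>b\<in>Basis. (h \<bullet> b) *\<^sub>R b)"
      by (simp only: euclidean_representation)
    also have "\<dots> = (\<Sum>b\<in>Basis. (h \<bullet> b) * f' b)"
      by (simp only: f'.sum f'.scale real_scaleR_def)
    also have "\<dots> = h \<bullet> g"
      by (simp only: g_def inner_sum_right inner_scaleR_right mult.commute)
    finally show ?thesis .
  qed
  then have "f' = (\<lambda>h. h \<bullet> g)"
    by blast
  with f' have ex: "GDERIV f x :> g"
    by (simp only: gderiv_def)
  have "d = e" if "GDERIV f x :> d" "GDERIV f x :> e" for d e
  proof -
    have "(\<lambda>h. h \<bullet> d) = (\<lambda>h. h \<bullet> e)"
      using that unfolding gderiv_def by (rule has_derivative_unique)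
    then have "h \<bullet> d = h \<bullet> e" for h
      by (rule fun_cong)
    from this[of "d - e"] have "(d - e) \<bullet> (d - e) = 0"
      by (simp only: inner_diff_right)
    then show ?thesis
      by simp
  qed
  from theI[of "gderiv f x", OF ex this[OF _ ex]] show ?thesis
    by (simp only: gradient_def)
qed

lemma convex_on_gradient_inequality:
  fixes f :: "'a::euclidean_space \<Rightarrow> real"
  assumes "convex_on UNIV f" "f differentiable (at y)"
  shows "f x \<ge> f y + gradient f y \<bullet> (x - y)"
proof -
  define g where "g s = f (y + s *\<^sub>R (x - y))" for s
  have "convex_on UNIV g"
  proof (rule convex_onI)
    fix t a b :: real
    assume t: "0 < t" "t < 1"
    have "y + ((1 - t) * a + t * b) *\<^sub>R (x - y)
        = (1 - t) *\<^sub>R (y + a *\<^sub>R (x - y)) + t *\<^sub>R (y + b *\<^sub>R (x - y))"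
      by (simp add: algebra_simps)
    then show "g ((1 - t) *\<^sub>R a + t *\<^sub>R b) \<le> (1 - t) * g a + t * g b"
      using convex_onD[OF assms(1), of t] t by (simp add: g_def)
  qed auto
  moreover have "(g has_real_derivative gradient f y \<bullet> (x - y)) (at 0)"
  proof -
    have "(f has_derivative (\<lambda>h. h \<bullet> gradient f y)) (at (y + 0 *\<^sub>R (x - y)))"
      using GDERIV_gradient[OF assms(2)] by (simp add: gderiv_def)
    then have "((\<lambda>s. f (y + s *\<^sub>R (x - y))) has_derivative (\<lambda>s. (s *\<^sub>R (x - y)) \<bullet> gradient f y)) (at 0)"
      by (rule has_derivative_compose[rotated]) (auto intro!: derivative_eq_intros)
    then show ?thesis
      by (simp add: g_def[abs_def] has_field_derivative_def inner_commute mult.commute[of _ "gradient f y \<bullet> _"])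
  qed
  ultimately have "g 1 - g 0 \<ge> (gradient f y \<bullet> (x - y)) * (1 - 0)"
    by (intro convex_on_imp_above_tangent[of UNIV]) (auto simp: connected_UNIV)
  then show ?thesis
    by (simp add: g_def)
qed

subsection \<open>The parameter sequence\<close>

lemma \<theta>_pos: "\<theta> k > 0"
proof (induction k)
  case (Suc k)
  have "sqrt (\<theta> k ^ 4 + 4 * (\<theta> k)\<^sup>2) > sqrt (\<theta> k ^ 4)"
    using Suc by simp
  also have "sqrt (\<theta> k ^ 4) = (\<theta> k)\<^sup>2"
    by (rule real_sqrt_unique) auto
  finally show ?case by simp
qed simp

text \<open>With \<open>a\<close> the square of \<open>\<theta> k\<close>, the next parameter is the
  positive root of \<open>t\<^sup>2 + a * t - a = 0\<close>.\<close>

lemma \<theta>_Suc_power2: "(\<theta> (Suc k))\<^sup>2 = (1 - \<theta> (Suc k)) * (\<theta> k)\<^sup>2"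
proof -
  define a where "a = (\<theta> k)\<^sup>2"
  define r where "r = sqrt (a\<^sup>2 + 4 * a)"
  have r2: "r\<^sup>2 = a\<^sup>2 + 4 * a" by (simp add: r_def a_def)
  have "\<theta> (Suc k) = (r - a) / 2" by (simp add: r_def a_def)
  then have "r = a + 2 * \<theta> (Suc k)" by (simp del: \<theta>.simps)
  with r2 show ?thesis
    unfolding a_def[symmetric] by (simp add: power2_eq_square algebra_simps del: \<theta>.simps)
qed

lemma \<theta>_le_1: "\<theta> k \<le> 1"
proof (cases k)
  case (Suc j)
  have "(1 - \<theta> (Suc j)) * (\<theta> j)\<^sup>2 \<ge> 0"
    by (metis \<theta>_Suc_power2 zero_le_power2)
  then show ?thesis
    using \<theta>_pos[of j] Suc by (simp add: zero_le_mult_iff del: \<theta>.simps)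
qed simp

subsection \<open>The accelerated steps\<close>

locale composite_problem =
  fixes f :: "real ^ 'n \<Rightarrow> real" and \<psi> :: "real ^ 'n \<Rightarrow> ereal" and L :: "real ^ 'n"
  assumes convex_f: "convex_on UNIV f"
    and differentiable_f: "f differentiable (at x)"
    and proper_\<psi>: "proper_function \<psi>"
    and closed_\<psi>: "closed_function \<psi>"
    and convex_\<psi>: "convex_function \<psi>"
    and minimizers_nonempty: "minimizers (composite f \<psi>) \<noteq> {}"
    and smooth_f: "smoothness f L"
begin

section \<open>The composite objective, its minimizers and its proximal subproblems\<close>

abbreviation "F \<equiv> composite f \<psi>"
abbreviation "X \<equiv> minimizers F"

text \<open>\<open>P\<close> and \<open>G\<close> stand for \<psi> and \<open>F\<close> in real
  arithmetic, but only on the domain: elsewhere \<open>real_of_ereal\<close> turns infinity into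
  0.\<close>

definition P :: "real ^ 'n \<Rightarrow> real" where "P x = real_of_ereal (\<psi> x)"
definition G :: "real ^ 'n \<Rightarrow> real" where "G x = f x + P x"
definition Q :: "real ^ 'n \<Rightarrow> real" where "Q v = (wnorm L v)\<^sup>2"

lemma L_pos: "L $ i > 0"
  using smooth_f by (simp add: smoothness_def)

lemma Q_nonneg: "Q v \<ge> 0"
  by (simp add: Q_def)

lemma Q_scaleR: "Q (c *\<^sub>R v) = c\<^sup>2 * Q v"
  unfolding Q_def by (rule wnorm_scaleR_power2[OF L_pos])

lemma Q_minus_commute: "Q (v - w) = Q (w - v)"
  unfolding Q_def by (metis wnorm_minus_commute)

lemma f_upper: "f x \<le> f y + gradient f y \<bullet> (x - y) + Q (x - y) / 2"
  using smooth_f by (simp add: smoothness_def Q_def)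

lemma f_lower: "f x \<ge> f y + gradient f y \<bullet> (x - y)"
  by (rule convex_on_gradient_inequality[OF convex_f differentiable_f])

lemma \<psi>_eq: "x \<in> domain_of \<psi> \<Longrightarrow> \<psi> x = ereal (P x)"
  using proper_\<psi> by (cases "\<psi> x") (auto simp: domain_of_def P_def proper_function_def)

lemma \<psi>_infinity: "x \<notin> domain_of \<psi> \<Longrightarrow> \<psi> x = \<infinity>"
  by (simp add: domain_of_def)

lemma le_ereal_iff: "\<psi> x \<le> ereal r \<longleftrightarrow> x \<in> domain_of \<psi> \<and> P x \<le> r"
  using \<psi>_eq \<psi>_infinity by (cases "x \<in> domain_of \<psi>") auto

lemma F_eq: "x \<in> domain_of \<psi> \<Longrightarrow> F x = ereal (G x)"
  by (simp add: composite_def \<psi>_eq G_def)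

lemma domain_of_F: "domain_of F = domain_of \<psi>"
  by (auto simp: domain_of_def composite_def)

lemma domain_nonempty: "domain_of \<psi> \<noteq> {}"
  using proper_\<psi> by (auto simp: domain_of_def proper_function_def)

lemma P_convex:
  assumes "x \<in> domain_of \<psi>" "u \<in> domain_of \<psi>" "0 \<le> s" "s \<le> 1"
  shows "(1 - s) *\<^sub>R x + s *\<^sub>R u \<in> domain_of \<psi>"
    and "P ((1 - s) *\<^sub>R x + s *\<^sub>R u) \<le> (1 - s) * P x + s * P u"
proof -
  have "(1 - s) *\<^sub>R (x, P x) + s *\<^sub>R (u, P u) \<in> ereal_epigraph \<psi>"
    using convex_\<psi> assms unfolding convex_function_def
    by (intro convexD) (auto simp: ereal_epigraph_def \<psi>_eq)
  then show "(1 - s) *\<^sub>R x + s *\<^sub>R u \<in> domain_of \<psi>"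
    "P ((1 - s) *\<^sub>R x + s *\<^sub>R u) \<le> (1 - s) * P x + s * P u"
    by (auto simp: ereal_epigraph_def le_ereal_iff)
qed

lemma G_convex:
  assumes "x \<in> domain_of \<psi>" "u \<in> domain_of \<psi>" "0 \<le> s" "s \<le> 1"
  shows "G ((1 - s) *\<^sub>R x + s *\<^sub>R u) \<le> (1 - s) * G x + s * G u"
  using P_convex(2)[OF assms] convex_onD[OF convex_f, of s x u] assms
  by (simp add: G_def algebra_simps)

lemma minimizers_iff: "u \<in> X \<longleftrightarrow> u \<in> domain_of \<psi> \<and> (\<forall>w\<in>domain_of \<psi>. G u \<le> G w)"
proof -
  have infinity: "F w = \<infinity>" if "w \<notin> domain_of \<psi>" for w
    using that by (simp add: composite_def \<psi>_infinity)
  obtain v where v: "v \<in> domain_of \<psi>"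
    using domain_nonempty by blast
  show ?thesis
  proof
    assume u: "u \<in> X"
    then have "F u \<le> F v" by (simp add: minimizers_def)
    then have "u \<in> domain_of \<psi>"
      using infinity[of u] F_eq[OF v] by force
    then show "u \<in> domain_of \<psi> \<and> (\<forall>w\<in>domain_of \<psi>. G u \<le> G w)"
      using u by (auto simp: minimizers_def F_eq dest: spec)
        (metis F_eq ereal_less_eq(3))
  next
    assume u: "u \<in> domain_of \<psi> \<and> (\<forall>w\<in>domain_of \<psi>. G u \<le> G w)"
    then have "F u \<le> F w" for w
      using infinity[of w] F_eq by (cases "w \<in> domain_of \<psi>") auto
    then show "u \<in> X" by (simp add: minimizers_def)
  qed
qed

lemma opt_value_eq: "u \<in> X \<Longrightarrow> opt_value F = ereal (G u)"
proof -
  assume u: "u \<in> X"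
  then have "opt_value F = F u"
    unfolding opt_value_def minimizers_def by (intro INF_eqI) auto
  then show ?thesis
    using u by (simp add: minimizers_iff F_eq)
qed

lemma convex_minimizers: "convex X"
proof (rule convexI)
  fix x y :: "real ^ 'n" and u v :: real
  assume A: "x \<in> X" "y \<in> X" "0 \<le> u" "0 \<le> v" "u + v = 1"
  then have D: "x \<in> domain_of \<psi>" "y \<in> domain_of \<psi>" and u: "u = 1 - v" "v \<le> 1"
    by (auto simp: minimizers_iff)
  have "G x = G y"
    using A by (auto simp: minimizers_iff intro!: antisym)
  then have "G ((1 - v) *\<^sub>R x + v *\<^sub>R y) \<le> G x"
    using G_convex[OF D \<open>0 \<le> v\<close> u(2)] by (simp add: algebra_simps)
  then show "u *\<^sub>R x + v *\<^sub>R y \<in> X"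
    using P_convex(1)[OF D \<open>0 \<le> v\<close> u(2)] A(1) unfolding minimizers_iff u(1) by fastforce
qed

text \<open>First-order optimality: \<open>- gradient f u\<close> is a subgradient of \<open>\<psi>\<close> at the minimizer \<open>u\<close>.\<close>

lemma affine_minorant:
  assumes "u \<in> X" "x \<in> domain_of \<psi>"
  shows "P x \<ge> P u - gradient f u \<bullet> (x - u)"
proof -
  have u: "u \<in> domain_of \<psi>" using assms by (simp add: minimizers_iff)
  \<comment> \<open>Moving from \<open>u\<close> a fraction \<open>s\<close> towards
    \<open>x\<close>, the smoothness bound leaves an error of order \<open>s\<^sup>2\<close>, which
    is still of order \<open>s\<close> after division by \<open>s\<close>.\<close>
  have "P u - gradient f u \<bullet> (x - u) \<le> P x + s * (Q (x - u) / 2)" if s: "0 < s" "s < 1" for s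
  proof -
    let ?w = "(1 - s) *\<^sub>R u + s *\<^sub>R x"
    have w: "?w - u = s *\<^sub>R (x - u)" by (simp add: algebra_simps)
    have "G u \<le> G ?w"
      using assms P_convex(1)[OF u assms(2), of s] s by (simp add: minimizers_iff)
    also have "\<dots> \<le> f u + gradient f u \<bullet> (?w - u) + Q (?w - u) / 2 + (1 - s) * P u + s * P x"
      using f_upper[of ?w u] P_convex(2)[OF u assms(2), of s] s by (simp add: G_def)
    finally have "s * (P u - gradient f u \<bullet> (x - u)) \<le> s * (P x + s * (Q (x - u) / 2))"
      unfolding w Q_scaleR by (simp add: G_def algebra_simps power2_eq_square)
    then show ?thesis using s by simp
  qed
  then show ?thesis by (rule le_if_le_plus_small_multiple)
qed

text \<open>Without attainment the \<open>arg_min\<close> in both methods would say nothing. An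
  affine minorant of \<psi>, available at a minimizer of \<open>F\<close>, and the quadratic term
  bound the sublevel set. The minimum is then sought over pairs (point, height) in a compact slice
  of the epigraph, where the objective \<open>h\<close> plus height is continuous; closedness of
  \<psi> enters directly as closedness of the epigraph.\<close>

lemma prox_objective_attains_min:
  fixes a y c :: "real ^ 'n"
  assumes "t > 0"
  defines "h \<equiv> \<lambda>x. a \<bullet> (x - y) + t / 2 * Q (x - c)"
  shows "\<exists>p\<in>domain_of \<psi>. \<forall>u\<in>domain_of \<psi>. h p + P p \<le> h u + P u"
proof -
  obtain v where v: "v \<in> X" using minimizers_nonempty by blast
  obtain u0 where u0: "u0 \<in> domain_of \<psi>" using domain_nonempty by blast
  obtain l where l: "l > 0" "\<And>x. Q x \<ge> l * (norm x)\<^sup>2"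
    unfolding Q_def using wnorm_power2_ge_norm_power2[of L] L_pos by blast
  define M where "M = h u0 + P u0"
  define m where "m x = P v - gradient f v \<bullet> (x - v)" for x
  have m: "m x \<le> P x" if "x \<in> domain_of \<psi>" for x
    unfolding m_def using affine_minorant[OF v that] .
  define A where "A = t / 2 * l"
  define B where "B = norm (a - gradient f v)"
  \<comment> \<open>Recentring at \<open>c\<close> turns \<open>h x + m x \<le> M\<close> into
    \<open>(a - gradient f v) \<bullet> (x - c) + t / 2 * Q (x - c) \<le> C\<close>.\<close>
  define C where "C = M - a \<bullet> (c - y) - P v + gradient f v \<bullet> (c - v)"
  \<comment> \<open>For \<open>r > R\<close> one has \<open>A * r - B > \<bar>C\<bar>\<close>; the
    summand 1 ensures \<open>R \<ge> 1\<close>, so multiplying by \<open>r\<close> preserves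
    this.\<close>
  define R where "R = (B + \<bar>C\<bar>) / A + 1"
  have A: "A > 0" using assms l by (simp add: A_def)
  have R: "x \<in> cball c R" if "h x + m x \<le> M" for x
  proof (rule ccontr)
    assume "x \<notin> cball c R"
    define r where "r = norm (x - c)"
    have r: "r > R" using \<open>x \<notin> cball c R\<close> by (simp add: r_def dist_norm norm_minus_commute)
    have "R \<ge> 1" using A by (simp add: R_def B_def)
    have "t / 2 * Q (x - c) \<ge> A * r\<^sup>2"
      using l(2)[of "x - c"] assms by (simp add: A_def r_def)
    moreover have "(a - gradient f v) \<bullet> (x - c) \<ge> - (B * r)"
      using Cauchy_Schwarz_ineq2[of "a - gradient f v" "x - c"] by (simp add: B_def r_def abs_le_iff)
    moreover have "(a - gradient f v) \<bullet> (x - c) + t / 2 * Q (x - c) \<le> C"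
      using that by (simp add: h_def m_def C_def algebra_simps)
    ultimately have "A * r\<^sup>2 - B * r \<le> C" by linarith
    moreover have "A * r > B + \<bar>C\<bar>"
    proof -
      have "A * r > A * R" using r A by simp
      moreover have "A * R = B + \<bar>C\<bar> + A" using A by (simp add: R_def field_simps)
      ultimately show ?thesis using A by linarith
    qed
    then have "(A * r - B) * r > \<bar>C\<bar>"
    proof -
      assume "A * r > B + \<bar>C\<bar>"
      then have "A * r - B > \<bar>C\<bar>" by simp
      also have "(A * r - B) \<le> (A * r - B) * r"
        using \<open>A * r - B > \<bar>C\<bar>\<close> \<open>R \<ge> 1\<close> r by (intro mult_left_le[of 1 r, simplified] mult_le_cancel_left1[THEN iffD2]) auto
      finally show ?thesis by simp
    qed
    ultimately show False by (simp add: power2_eq_square algebra_simps)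
  qed
  have cont_h: "continuous_on UNIV h"
    unfolding h_def Q_def by (intro continuous_intros continuous_on_wnorm_power2 L_pos)
  have cont_m: "continuous_on UNIV m"
    unfolding m_def by (intro continuous_intros)
  have "bounded (h ` cball c R)" "bounded (m ` cball c R)"
    by (auto intro!: compact_imp_bounded compact_continuous_image
        continuous_on_subset[OF cont_h] continuous_on_subset[OF cont_m])
  then obtain H N where "\<forall>x\<in>cball c R. \<bar>h x\<bar> \<le> H" "\<forall>x\<in>cball c R. \<bar>m x\<bar> \<le> N"
    by (auto simp: bounded_iff)
  then have HN: "\<bar>h x\<bar> \<le> H" "\<bar>m x\<bar> \<le> N" if "x \<in> cball c R" for x
    using that by auto
  define S where "S = ereal_epigraph \<psi> \<inter> {q. h (fst q) + snd q \<le> M}"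
  have S: "q \<in> S \<longleftrightarrow> fst q \<in> domain_of \<psi> \<and> P (fst q) \<le> snd q \<and> h (fst q) + snd q \<le> M" for q
    by (cases q) (auto simp: S_def ereal_epigraph_def le_ereal_iff)
  have cont: "continuous_on UNIV (\<lambda>q. h (fst q) + snd q)"
    by (intro continuous_intros continuous_on_compose2[OF cont_h]) auto
  \<comment> \<open>Heights are bounded below by the affine minorant and above by the level
    condition.\<close>
  have "S \<subseteq> cball c R \<times> {-N..M + H}"
  proof
    fix q assume q: "q \<in> S"
    then have le: "m (fst q) \<le> snd q" "h (fst q) + snd q \<le> M"
      using m[of "fst q"] by (auto simp: S)
    then have "fst q \<in> cball c R" by (intro R) simp
    then show "q \<in> cball c R \<times> {-N..M + H}"
      using HN[of "fst q"] le by (cases q) (auto simp: abs_le_iff)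
  qed
  moreover have "bounded (cball c R \<times> {-N..M + H})"
    by (intro bounded_Times) auto
  ultimately have "bounded S"
    by (rule bounded_subset[rotated])
  moreover have "closed S"
    unfolding S_def
    using closed_\<psi> by (intro closed_Int closed_Collect_le cont) (auto simp: closed_function_def)
  ultimately have "compact S" by (simp add: compact_eq_bounded_closed)
  moreover have "(u0, P u0) \<in> S" using u0 by (simp add: S M_def)
  ultimately obtain q where q: "q \<in> S" "\<forall>q'\<in>S. h (fst q) + snd q \<le> h (fst q') + snd q'"
    using continuous_attains_inf[of S "\<lambda>q. h (fst q) + snd q"] continuous_on_subset[OF cont]
    by blast
  have "h (fst q) + P (fst q) \<le> h u + P u" if u: "u \<in> domain_of \<psi>" for u
  proof (cases "h u + P u \<le> M")
    case True
    then have "(u, P u) \<in> S" using u by (simp add: S)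
    then have "h (fst q) + snd q \<le> h u + P u" using q(2) by fastforce
    then show ?thesis using q(1) by (simp add: S)
  next
    case False
    then show ?thesis using q(1) by (simp add: S)
  qed
  then show ?thesis using q(1) by (auto simp: S)
qed

text \<open>The gap \<open>t / 2 * Q (u - p)\<close> reflects strong convexity: comparing
  \<open>p\<close> with \<open>(1 - s) *\<^sub>R p + s *\<^sub>R u\<close> and dividing by
  \<open>s\<close> leaves it with factor \<open>1 - s\<close>, and \<open>s\<close> tends to
  0.\<close>

lemma prox_three_point:
  fixes a y c :: "real ^ 'n"
  assumes "t > 0"
  defines "h \<equiv> \<lambda>x. a \<bullet> (x - y) + t / 2 * (wnorm L (x - c))\<^sup>2"
  defines "p \<equiv> arg_min (\<lambda>x. ereal (h x) + \<psi> x) (\<lambda>x. True)"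
  shows "p \<in> domain_of \<psi>"
    and "u \<in> domain_of \<psi> \<Longrightarrow> h p + P p + t / 2 * Q (u - p) \<le> h u + P u"
proof -
  let ?\<phi> = "\<lambda>x. ereal (h x) + \<psi> x"
  obtain p0 where p0: "p0 \<in> domain_of \<psi>" "\<forall>u\<in>domain_of \<psi>. h p0 + P p0 \<le> h u + P u"
    using prox_objective_attains_min[OF assms(1), of a y c] by (auto simp: h_def Q_def)
  have "?\<phi> p0 \<le> ?\<phi> u" for u
    using p0 by (cases "u \<in> domain_of \<psi>") (auto simp: \<psi>_eq \<psi>_infinity)
  then have "is_arg_min ?\<phi> (\<lambda>x. True) p0"
    by (simp add: is_arg_min_linorder)
  then have "is_arg_min ?\<phi> (\<lambda>x. True) p"
    unfolding p_def arg_min_def by (rule someI)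
  then have p: "?\<phi> p \<le> ?\<phi> u" for u
    by (simp add: is_arg_min_linorder)
  show dom: "p \<in> domain_of \<psi>"
    using p[of p0] p0(1) by (cases "p \<in> domain_of \<psi>") (auto simp: \<psi>_eq \<psi>_infinity)
  assume u: "u \<in> domain_of \<psi>"
  have "h p + P p + t / 2 * Q (u - p) \<le> h u + P u + s * (t / 2 * Q (u - p))"
    if s: "0 < s" "s < 1" for s
  proof -
    let ?w = "(1 - s) *\<^sub>R p + s *\<^sub>R u"
    have w: "?w \<in> domain_of \<psi>" using P_convex(1)[OF dom u] s by simp
    have "h p + P p \<le> h ?w + P ?w"
      using p[of ?w] by (simp add: \<psi>_eq dom w)
    also have "\<dots> \<le> h ?w + (1 - s) * P p + s * P u"
      using P_convex(2)[OF dom u, of s] s by simp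
    also have "h ?w = (1 - s) * h p + s * h u - t / 2 * (s * (1 - s) * Q (u - p))"
    proof -
      have 1: "?w - y = (1 - s) *\<^sub>R (p - y) + s *\<^sub>R (u - y)"
        and 2: "?w - c = (1 - s) *\<^sub>R (p - c) + s *\<^sub>R (u - c)"
        by (simp_all add: algebra_simps)
      have "a \<bullet> (?w - y) = (1 - s) * (a \<bullet> (p - y)) + s * (a \<bullet> (u - y))"
        unfolding 1 by (simp only: inner_add_right inner_scaleR_right)
      moreover have "(wnorm L (?w - c))\<^sup>2
          = (1 - s) * (wnorm L (p - c))\<^sup>2 + s * (wnorm L (u - c))\<^sup>2 - s * (1 - s) * Q (p - u)"
        unfolding 2 wnorm_power2_convex_combination[OF L_pos] by (simp add: Q_def)
      ultimately have "h ?w = (1 - s) * (a \<bullet> (p - y)) + s * (a \<bullet> (u - y)) + t / 2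
          * ((1 - s) * (wnorm L (p - c))\<^sup>2 + s * (wnorm L (u - c))\<^sup>2 - s * (1 - s) * Q (p - u))"
        by (simp only: h_def)
      also have "\<dots> = (1 - s) * h p + s * h u - t / 2 * (s * (1 - s) * Q (u - p))"
        by (simp add: h_def Q_minus_commute[of u p] algebra_simps diff_divide_distrib)
      finally show ?thesis .
    qed
    finally have "s * (h p + P p + t / 2 * Q (u - p)) \<le> s * (h u + P u + s * (t / 2 * Q (u - p)))"
      by (simp add: algebra_simps)
    then show ?thesis using s by simp
  qed
  then show "h p + P p + t / 2 * Q (u - p) \<le> h u + P u"
    by (rule le_if_le_plus_small_multiple)
qed

text \<open>The interface between the algorithms and the convergence analysis, which uses nothing
  else about the steps. The identity for \<open>x'\<close> is kept because the second bound applies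
  convexity of the squared distance to it.\<close>

definition accelerated_step ::
    "real \<Rightarrow> (real ^ 'n) \<times> (real ^ 'n) \<Rightarrow> (real ^ 'n) \<times> (real ^ 'n) \<Rightarrow> bool" where
  "accelerated_step t = (\<lambda>(x, z) (x', z'). x' \<in> domain_of \<psi> \<and> x' = (1 - t) *\<^sub>R x + t *\<^sub>R z' \<and>
     (\<forall>w\<in>domain_of \<psi>. G x' \<le> (1 - t) * G x + t * G w + t\<^sup>2 / 2 * (Q (w - z) - Q (w - z'))))"

text \<open>The proximal inequality is tested at \<open>(1 - t) *\<^sub>R x + t *\<^sub>R w\<close>,
  whose differences to \<open>y\<close> and \<open>x'\<close> are \<open>t\<close> times
  \<open>w - z\<close> and \<open>w - z'\<close>. Smoothness at \<open>x'\<close> and convexity of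
  \<open>f\<close> at the test point do the rest.\<close>

lemma fista_accelerated_step:
  fixes x z :: "real ^ 'n"
  assumes t: "0 < t" "t \<le> 1" and x: "x \<in> domain_of \<psi>"
  defines "y \<equiv> (1 - t) *\<^sub>R x + t *\<^sub>R z"
  defines "x' \<equiv> fista_step f \<psi> L y"
  shows "accelerated_step t (x, z) (x', z + (1 / t) *\<^sub>R (x' - y))"
proof -
  define z' where "z' = z + (1 / t) *\<^sub>R (x' - y)"
  have z': "t *\<^sub>R z' = x' - (1 - t) *\<^sub>R x"
    using t by (simp add: z'_def y_def algebra_simps)
  have step: "x' \<in> domain_of \<psi>"
    "u \<in> domain_of \<psi> \<Longrightarrow> gradient f y \<bullet> (x' - y) + 1 / 2 * Q (x' - y) + P x' + 1 / 2 * Q (u - x')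
      \<le> gradient f y \<bullet> (u - y) + 1 / 2 * Q (u - y) + P u" for u
    using prox_three_point[where t = 1 and a = "gradient f y" and y = y and c = y]
    by (simp_all add: x'_def fista_step_def Q_def)
  have "G x' \<le> (1 - t) * G x + t * G w + t\<^sup>2 / 2 * (Q (w - z) - Q (w - z'))"
    if w: "w \<in> domain_of \<psi>" for w
  proof -
    let ?u = "(1 - t) *\<^sub>R x + t *\<^sub>R w"
    have u: "?u \<in> domain_of \<psi>" using P_convex(1)[OF x w] t by simp
    have "?u - y = t *\<^sub>R (w - z)" "?u - x' = t *\<^sub>R (w - z')"
      using z' by (simp_all add: y_def algebra_simps)
    then have Q: "Q (?u - y) = t\<^sup>2 * Q (w - z)" "Q (?u - x') = t\<^sup>2 * Q (w - z')"
      by (simp_all add: Q_scaleR)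
    have "G x' \<le> f y + gradient f y \<bullet> (x' - y) + Q (x' - y) / 2 + P x'"
      using f_upper[of x' y] by (simp add: G_def)
    also have "\<dots> \<le> f y + gradient f y \<bullet> (?u - y) + Q (?u - y) / 2 + P ?u - Q (?u - x') / 2"
      using step(2)[OF u] by simp
    also have "\<dots> \<le> G ?u + Q (?u - y) / 2 - Q (?u - x') / 2"
      using f_lower[of y ?u] by (simp add: G_def)
    also have "\<dots> \<le> (1 - t) * G x + t * G w + t\<^sup>2 / 2 * (Q (w - z) - Q (w - z'))"
      using G_convex[OF x w, of t] t unfolding Q by (simp add: algebra_simps)
    finally show ?thesis .
  qed
  then show ?thesis
    unfolding accelerated_step_def z'_def[symmetric] using step(1) z' by simp
qed

text \<open>Here the proximal inequality is tested at \<open>w\<close> itself, and convexity of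
  \<psi> is applied to \<open>x'\<close> as a combination of \<open>x\<close> and \<open>z'\<close>.
  The weight \<open>t / 2\<close> in the subproblem, times \<open>t\<close>, matches the smoothness
  term \<open>Q (x' - y) / 2\<close>.\<close>

lemma apg_accelerated_step:
  fixes x z :: "real ^ 'n"
  assumes t: "0 < t" "t \<le> 1" and x: "x \<in> domain_of \<psi>"
  defines "y \<equiv> (1 - t) *\<^sub>R x + t *\<^sub>R z"
  defines "z' \<equiv> apg_step f \<psi> L t y z"
  shows "accelerated_step t (x, z) (y + t *\<^sub>R (z' - z), z')"
proof -
  define x' where "x' = y + t *\<^sub>R (z' - z)"
  have x': "x' = (1 - t) *\<^sub>R x + t *\<^sub>R z'"
    by (simp add: x'_def y_def algebra_simps)
  have step: "z' \<in> domain_of \<psi>"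
    "u \<in> domain_of \<psi> \<Longrightarrow> gradient f y \<bullet> (z' - y) + t / 2 * Q (z' - z) + P z' + t / 2 * Q (u - z')
      \<le> gradient f y \<bullet> (u - y) + t / 2 * Q (u - z) + P u" for u
    using prox_three_point[OF t(1), where a = "gradient f y" and y = y and c = z]
    by (simp_all add: z'_def apg_step_def Q_def)
  have "G x' \<le> (1 - t) * G x + t * G w + t\<^sup>2 / 2 * (Q (w - z) - Q (w - z'))"
    if w: "w \<in> domain_of \<psi>" for w
  proof -
    have "x' - y = (1 - t) *\<^sub>R (x - y) + t *\<^sub>R (z' - y)"
      by (simp add: x' algebra_simps)
    then have inner: "gradient f y \<bullet> (x' - y)
        = (1 - t) * (gradient f y \<bullet> (x - y)) + t * (gradient f y \<bullet> (z' - y))"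
      by (simp add: inner_add_right)
    have Q: "Q (x' - y) = t\<^sup>2 * Q (z' - z)"
      by (simp add: x'_def Q_scaleR)
    have "G x' \<le> f y + gradient f y \<bullet> (x' - y) + Q (x' - y) / 2 + ((1 - t) * P x + t * P z')"
      using f_upper[of x' y] P_convex(2)[OF x step(1), of t] t by (simp add: G_def x')
    also have "\<dots> = (1 - t) * (f y + gradient f y \<bullet> (x - y) + P x)
        + t * (f y + (gradient f y \<bullet> (z' - y) + t / 2 * Q (z' - z) + P z'))"
      unfolding inner Q by (simp add: algebra_simps power2_eq_square)
    also have "\<dots> \<le> (1 - t) * G x + t * (G w + t / 2 * Q (w - z) - t / 2 * Q (w - z'))"
      using step(2)[OF w] f_lower[of y x] f_lower[of y w] t
      by (intro add_mono mult_left_mono) (auto simp: G_def)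
    also have "\<dots> = (1 - t) * G x + t * G w + t\<^sup>2 / 2 * (Q (w - z) - Q (w - z'))"
      by (simp add: algebra_simps power2_eq_square)
    finally show ?thesis .
  qed
  moreover have "x' \<in> domain_of \<psi>"
    unfolding x' using P_convex(1)[OF x step(1)] t by simp
  ultimately show ?thesis
    unfolding accelerated_step_def x'_def[symmetric] using x' by simp
qed

section \<open>The iterates of both methods\<close>

lemma accelerated_step_domain: "accelerated_step t q q' \<Longrightarrow> fst q' \<in> domain_of \<psi>"
  by (auto simp: accelerated_step_def split: prod.splits)

lemma fista_iter_accelerated:
  assumes "x0 \<in> domain_of \<psi>"
  shows "accelerated_step (\<theta> k) (fista_iter f \<psi> L x0 k) (fista_iter f \<psi> L x0 (Suc k))"
proof -
  \<comment> \<open>Each step needs the current point in the domain and puts the next one there, so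
    the step is proved conditionally first.\<close>
  have *: "accelerated_step (\<theta> k) (fista_iter f \<psi> L x0 k) (fista_iter f \<psi> L x0 (Suc k))"
    if "fst (fista_iter f \<psi> L x0 k) \<in> domain_of \<psi>" for k
    using fista_accelerated_step[OF \<theta>_pos[of k] \<theta>_le_1[of k] that,
        of "snd (fista_iter f \<psi> L x0 k)"]
    by (simp add: Let_def split_beta)
  have "fst (fista_iter f \<psi> L x0 k) \<in> domain_of \<psi>" for k
  proof (induction k)
    case (Suc k)
    show ?case by (rule accelerated_step_domain[OF *[OF Suc]])
  qed (simp add: assms)
  then show ?thesis by (rule *)
qed

lemma apg_iter_accelerated:
  assumes "x0 \<in> domain_of \<psi>"
  shows "accelerated_step (\<theta> k) (apg_iter f \<psi> L x0 k) (apg_iter f \<psi> L x0 (Suc k))"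
proof -
  have *: "accelerated_step (\<theta> k) (apg_iter f \<psi> L x0 k) (apg_iter f \<psi> L x0 (Suc k))"
    if "fst (apg_iter f \<psi> L x0 k) \<in> domain_of \<psi>" for k
    using apg_accelerated_step[OF \<theta>_pos[of k] \<theta>_le_1[of k] that,
        of "snd (apg_iter f \<psi> L x0 k)"]
    by (simp add: Let_def split_beta)
  have "fst (apg_iter f \<psi> L x0 k) \<in> domain_of \<psi>" for k
  proof (induction k)
    case (Suc k)
    show ?case by (rule accelerated_step_domain[OF *[OF Suc]])
  qed (simp add: assms)
  then show ?thesis by (rule *)
qed

subsection \<open>Convergence\<close>

lemma accelerated_estimate:
  assumes "q 0 = (x0, x0)" "\<And>k. accelerated_step (\<theta> k) (q k) (q (Suc k))" "w \<in> domain_of \<psi>"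
  shows "G (fst (q (Suc k))) - G w \<le> (\<theta> k)\<^sup>2 / 2 * (Q (w - x0) - Q (w - snd (q (Suc k))))"
proof (induction k)
  case 0
  \<comment> \<open>As \<open>\<theta> 0 = 1\<close>, the term with the previous value of
    \<open>G\<close> has coefficient 0.\<close>
  have "G (fst (q (Suc 0))) \<le> G w + 1 / 2 * (Q (w - x0) - Q (w - snd (q (Suc 0))))"
    using assms(2)[of 0] assms(1,3) unfolding accelerated_step_def split_beta by fastforce
  then show ?case by (simp add: field_simps)
next
  case (Suc k)
  define t where "t = \<theta> (Suc k)"
  define a where "a = \<theta> k"
  have t: "t \<le> 1" unfolding t_def by (rule \<theta>_le_1)
  have a: "(1 - t) * a\<^sup>2 = t\<^sup>2" unfolding t_def a_def by (rule \<theta>_Suc_power2[symmetric])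
  define U where "U = Q (w - snd (q (Suc k)))"
  define V where "V = Q (w - snd (q (Suc (Suc k))))"
  have "G (fst (q (Suc (Suc k)))) \<le> (1 - t) * G (fst (q (Suc k))) + t * G w + t\<^sup>2 / 2 * (U - V)"
    using assms(2)[of "Suc k"] assms(3)
    by (auto simp: accelerated_step_def split_beta U_def V_def t_def simp del: \<theta>.simps)
  then have "G (fst (q (Suc (Suc k)))) - G w
      \<le> (1 - t) * (G (fst (q (Suc k))) - G w) + t\<^sup>2 / 2 * (U - V)"
    by (simp add: algebra_simps)
  also have "\<dots> \<le> (1 - t) * (a\<^sup>2 / 2 * (Q (w - x0) - U)) + t\<^sup>2 / 2 * (U - V)"
    using Suc.IH t by (intro add_right_mono mult_left_mono) (auto simp: U_def a_def)
  also have "\<dots> = ((1 - t) * a\<^sup>2) / 2 * (Q (w - x0) - U) + t\<^sup>2 / 2 * (U - V)"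
    by simp
  \<comment> \<open>By \<open>a\<close> both brackets carry the same weight, so \<open>U\<close>
    cancels.\<close>
  also have "\<dots> = t\<^sup>2 / 2 * (Q (w - x0) - V)"
    unfolding a by (simp add: field_simps)
  finally show ?case
    by (simp only: t_def V_def)
qed

lemma accelerated_contraction:
  assumes q: "q 0 = (x0, x0)" "\<And>k. accelerated_step (\<theta> k) (q k) (q (Suc k))"
    and x0: "x0 \<in> domain_of \<psi>"
    and eb: "local_quadratic_error_bound F L \<mu>"
  shows "(wdist L (fst (q (Suc k))) X)\<^sup>2
    \<le> min ((\<theta> k)\<^sup>2 / \<mu> x0) (1 / (1 + \<mu> x0 / (2 * (\<theta> k)\<^sup>2))) * (wdist L x0 X)\<^sup>2"
proof -
  define m where "m = \<mu> x0"
  define d where "d x = (wdist L x X)\<^sup>2" for x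
  have m: "m > 0"
    using eb x0 unfolding m_def local_quadratic_error_bound_def domain_of_F by blast
  obtain v where v: "v \<in> X" using minimizers_nonempty by blast
  have opt: "opt_value F = ereal (G v)" by (rule opt_value_eq[OF v])
  have dom: "fst (q (Suc k)) \<in> domain_of \<psi>" for k
    using accelerated_step_domain[OF q(2)] .
  have growth: "m / 2 * d (fst (q (Suc k))) \<le> G (fst (q (Suc k))) - G v" for k
  proof -
    have "G (fst (q (Suc k))) - G x0 \<le> - ((\<theta> k)\<^sup>2 / 2 * Q (x0 - snd (q (Suc k))))"
      \<comment> \<open>The instance of \<open>Q_scaleR\<close> supplies
        \<open>Q 0 = 0\<close>.\<close>
      using accelerated_estimate[OF q x0, of k] Q_scaleR[of 0 0] by simp
    also have "\<dots> \<le> 0" using Q_nonneg by simp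
    finally have "F (fst (q (Suc k))) \<le> F x0"
      by (simp add: F_eq dom x0)
    then have "opt_value F + ereal (m / 2 * d (fst (q (Suc k)))) \<le> F (fst (q (Suc k)))"
      using eb x0 unfolding m_def d_def local_quadratic_error_bound_def domain_of_F by blast
    then show ?thesis
      by (simp add: opt F_eq dom)
  qed
  have main: "d (snd (q (Suc k))) + m / (\<theta> k)\<^sup>2 * d (fst (q (Suc k))) \<le> d x0" for k
    unfolding d_def[of x0]
  \<comment> \<open>The infimum over minimizers is taken only on the \<open>x0\<close> side; on the
    other side each minimizer \<open>u\<close> already bounds the distance from above.\<close>
  proof (rule le_wdist_power2I[OF minimizers_nonempty L_pos])
    fix u assume u: "u \<in> X"
    have "G u = G v"
      using opt_value_eq[OF u] opt by simp
    moreover have "u \<in> domain_of \<psi>" using u by (simp add: minimizers_iff)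
    ultimately have "m / 2 * d (fst (q (Suc k)))
        \<le> (\<theta> k)\<^sup>2 / 2 * (Q (u - x0) - Q (u - snd (q (Suc k))))"
      using accelerated_estimate[OF q, of u k] growth[of k] by linarith
    then have "m / (\<theta> k)\<^sup>2 * d (fst (q (Suc k))) \<le> Q (u - x0) - Q (u - snd (q (Suc k)))"
      using \<theta>_pos[of k] by (simp add: field_simps)
    moreover have "d (snd (q (Suc k))) \<le> Q (u - snd (q (Suc k)))"
      using wdist_power2_le[OF L_pos u, of "snd (q (Suc k))"]
      unfolding d_def Q_minus_commute[of u] by (simp add: Q_def)
    ultimately show "d (snd (q (Suc k))) + m / (\<theta> k)\<^sup>2 * d (fst (q (Suc k))) \<le> (wnorm L (x0 - u))\<^sup>2"
      unfolding Q_minus_commute[of u] by (simp add: Q_def)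
  qed
  have d_nonneg: "d x \<ge> 0" for x by (simp add: d_def)
  have first: "d (fst (q (Suc k))) \<le> (\<theta> k)\<^sup>2 / m * d x0"
  proof -
    have "m / (\<theta> k)\<^sup>2 * d (fst (q (Suc k))) \<le> d x0"
      using main[of k] d_nonneg[of "snd (q (Suc k))"] by linarith
    then show ?thesis
      using \<theta>_pos[of k] m by (simp add: field_simps)
  qed
  have rec: "d (fst (q (Suc k))) * (1 + m / \<theta> k) \<le> (1 - \<theta> k) * d (fst (q k)) + \<theta> k * d x0" for k
  proof -
    have x: "fst (q (Suc k)) = (1 - \<theta> k) *\<^sub>R fst (q k) + \<theta> k *\<^sub>R snd (q (Suc k))"
      using q(2)[of k] by (auto simp: accelerated_step_def split_beta)
    have "d (fst (q (Suc k))) \<le> (1 - \<theta> k) * d (fst (q k)) + \<theta> k * d (snd (q (Suc k)))"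
      unfolding x d_def using \<theta>_pos[of k] \<theta>_le_1[of k]
      by (intro wdist_power2_convex convex_minimizers minimizers_nonempty L_pos) auto
    also have "\<theta> k * d (snd (q (Suc k))) \<le> \<theta> k * (d x0 - m / (\<theta> k)\<^sup>2 * d (fst (q (Suc k))))"
      using main[of k] \<theta>_pos[of k] by (intro mult_left_mono) auto
    also have "\<dots> = \<theta> k * d x0 - m / \<theta> k * d (fst (q (Suc k)))"
      using \<theta>_pos[of k] by (simp add: field_simps power2_eq_square)
    finally show ?thesis by (simp add: algebra_simps)
  qed
  have second: "d (fst (q (Suc k))) * (1 + m / (2 * (\<theta> k)\<^sup>2)) \<le> d x0" for k
  proof (induction k)
    case 0
    \<comment> \<open>For \<open>k = 0\<close> the recursion yields the factor \<open>1 + m\<close>,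
      stronger than the claimed \<open>1 + m / 2\<close>.\<close>
    have "d (fst (q (Suc 0))) * (1 + m / 2) \<le> d (fst (q (Suc 0))) * (1 + m)"
      using d_nonneg m by (intro mult_left_mono) auto
    then show ?case using rec[of 0] by simp
  next
    case (Suc k)
    define t where "t = \<theta> (Suc k)"
    define a where "a = m / (2 * t\<^sup>2)"
    define x where "x = d (fst (q (Suc k)))"
    define x' where "x' = d (fst (q (Suc (Suc k))))"
    define D where "D = d x0"
    have t: "0 < t" "t \<le> 1" unfolding t_def by (rule \<theta>_pos, rule \<theta>_le_1)
    have a: "a > 0" using m t by (simp add: a_def)
    have t2: "t\<^sup>2 = (1 - t) * (\<theta> k)\<^sup>2" unfolding t_def by (rule \<theta>_Suc_power2)
    \<comment> \<open>\<open>t = 1\<close> would force \<open>t\<^sup>2 = 0\<close> in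
      \<open>t2\<close>.\<close>
    then have "1 - t \<noteq> 0" using t by auto
    then have "m / (2 * (\<theta> k)\<^sup>2) = a * (1 - t)"
      unfolding a_def t2 by simp
    then have x: "x * (1 + a * (1 - t)) \<le> D"
      using Suc.IH by (simp add: x_def D_def)
    have x': "x' * (1 + 2 * a * t) \<le> (1 - t) * x + t * D"
    proof -
      have "m / t = 2 * a * t" using t by (simp add: a_def field_simps power2_eq_square)
      then show ?thesis using rec[of "Suc k"] by (simp add: x_def x'_def D_def t_def del: \<theta>.simps)
    qed
    \<comment> \<open>The hypothesis has factor \<open>s\<close>, the recursion
      \<open>1 + 2 * a * t\<close>, the goal \<open>1 + a\<close>. After cross-multiplication the
      goal reduces to \<open>(1 + a) * ((1 - t) + t * s) \<le> (1 + 2 * a * t) * s\<close>, with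
      slack \<open>a * t\<^sup>2 + a\<^sup>2 * t * (1 - t)\<close>.\<close>
    define s where "s = 1 + a * (1 - t)"
    have s: "s > 0" using a t by (simp add: s_def add_pos_nonneg)
    have "(x' * (1 + a)) * ((1 + 2 * a * t) * s) = (1 + a) * s * (x' * (1 + 2 * a * t))"
      by (simp add: algebra_simps)
    also have "\<dots> \<le> (1 + a) * s * ((1 - t) * x + t * D)"
      using x' a s by (intro mult_left_mono) auto
    also have "\<dots> = (1 + a) * ((1 - t) * (x * s) + t * s * D)"
      by (simp add: algebra_simps)
    also have "\<dots> \<le> (1 + a) * ((1 - t) * D + t * s * D)"
      using x a t by (intro mult_left_mono add_right_mono) (auto simp: s_def)
    also have "\<dots> = D * ((1 + 2 * a * t) * s - a * t\<^sup>2 - a\<^sup>2 * t * (1 - t))"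
      by (simp add: s_def algebra_simps power2_eq_square)
    also have "\<dots> \<le> D * ((1 + 2 * a * t) * s)"
    proof -
      have "a * t\<^sup>2 \<ge> 0" "a\<^sup>2 * t * (1 - t) \<ge> 0" using a t by auto
      then show ?thesis
        using d_nonneg[of x0] unfolding D_def by (intro mult_left_mono) linarith+
    qed
    finally have "x' * (1 + a) \<le> D"
      using a t s by (simp add: add_pos_pos)
    then show ?case
      by (simp add: x'_def a_def D_def t_def del: \<theta>.simps)
  qed
  have "1 + m / (2 * (\<theta> k)\<^sup>2) > 0"
    using m \<theta>_pos[of k] by (simp add: add_pos_pos)
  then have "d (fst (q (Suc k))) \<le> 1 / (1 + m / (2 * (\<theta> k)\<^sup>2)) * d x0"
    using second[of k] by (simp add: pos_le_divide_eq)
  with first show ?thesis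
    unfolding d_def m_def by (simp add: min_def)
qed

end

theorem theorem1:
  fixes f :: "real ^ 'n \<Rightarrow> real"
    and \<psi> :: "real ^ 'n \<Rightarrow> ereal"
    and L x0 xhat :: "real ^ 'n"
    and \<mu> :: "real ^ 'n \<Rightarrow> real"
    and K :: nat
  assumes "convex_on UNIV f"
    and "\<forall>x. f differentiable (at x)"
    and "proper_function \<psi>"
    and "closed_function \<psi>"
    and "convex_function \<psi>"
    and "minimizers (composite f \<psi>) \<noteq> {}"
    and "smoothness f L"
    and "local_quadratic_error_bound (composite f \<psi>) L \<mu>"
    and "x0 \<in> domain_of (composite f \<psi>)"
    and "K \<ge> 1"
    and "xhat = fista f \<psi> L x0 K \<or> xhat = apg f \<psi> L x0 K"
  shows "(wdist L xhat (minimizers (composite f \<psi>)))\<^sup>2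
    \<le> min ((\<theta> (K - 1))\<^sup>2 / \<mu> x0) (1 / (1 + \<mu> x0 / (2 * (\<theta> (K - 1))\<^sup>2)))
        * (wdist L x0 (minimizers (composite f \<psi>)))\<^sup>2"
proof -
  interpret composite_problem f \<psi> L
    using assms by unfold_locales auto
  \<comment> \<open>The parameter of the last step performed is \<open>\<theta> k\<close>, with
    \<open>k = K - 1\<close>.\<close>
  obtain k where K: "K = Suc k"
    using assms(10) by (cases K) auto
  have x0: "x0 \<in> domain_of \<psi>"
    using assms(9) by (simp add: domain_of_F)
  show ?thesis
    using assms(11)
  proof
    assume "xhat = fista f \<psi> L x0 K"
    then show ?thesis
      using accelerated_contraction[OF _ fista_iter_accelerated[OF x0] x0 assms(8), of k]
      by (simp add: fista_def K del: fista_iter.simps(2))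
  next
    assume "xhat = apg f \<psi> L x0 K"
    then show ?thesis
      using accelerated_contraction[OF _ apg_iter_accelerated[OF x0] x0 assms(8), of k]
      by (simp add: apg_def K del: apg_iter.simps(2))
  qed
qed

end
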